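(* A minimal generating set for $ESL_3(\mathbb{Z})$ consists of the $2$ generators $$P=\begin{pmatrix}0&-1&0\\0&0&1\\1&0&0\end{pmatrix}\quad\text{and}\quad t_{12}=\begin{pmatrix}1&1&0\\0&1&0\\0&0&1\end{pmatrix}.$$
   Context: $ESL_3(\mathbb{Z})$ denotes the group of all $3\times 3$ integer matrices with determinant $1$ or $-1$. A generating set is minimal if no generating set of smaller cardinality exists. *)

theory Defs
  imports "HOL-Analysis.Analysis" "HOL-Algebra.Generated_Groups" "HOL-Library.Equipollence"
begin

definition ESL3 :: "(int^3^3) monoid" where
  "ESL3 = \<lparr>carrier = {A. det A = 1 \<or> det A = -1}, mult = (**), one = mat 1\<rparr>"

lemma group_ESL3: "group ESL3"
proof (rule groupI)
  fix A assume A: "A \<in> carrier ESL3"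
  define B :: "int^3^3" where "B = (\<chi> i j. det A *
    (A$(j+1)$(i+1) * A$(j+2)$(i+2) - A$(j+1)$(i+2) * A$(j+2)$(i+1)))"
  have n: "(4::3) = 1" "(5::3) = 2" "(3::3) = 0" by simp_all
  have sq: "det A * det A = 1" using A by (auto simp: ESL3_def)
  have "B ** A = (\<chi> i j. if i = j then det A * det A else 0)"
    by (simp add: B_def vec_eq_iff matrix_matrix_mult_def sum_3 forall_3 n det_3[of A])
       (simp add: algebra_simps)
  then have BA: "B ** A = mat 1" by (simp only: mat_def sq)
  then have "det B * det A = 1" by (metis det_I det_mul)
  then have "B \<in> carrier ESL3" using A by (auto simp: ESL3_def)
  then show "\<exists>B\<in>carrier ESL3. B \<otimes>\<^bsub>ESL3\<^esub> A = \<one>\<^bsub>ESL3\<^esub>"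
    using BA by (auto simp: ESL3_def)
qed (auto simp: ESL3_def det_mul matrix_mul_assoc)

text \<open>Cardinalities are compared by injections rather than by \<^const>\<open>card\<close>, which is
  \<open>0\<close> on infinite sets.\<close>

definition minimal_generating_set :: "('a, 'b) monoid_scheme \<Rightarrow> 'a set \<Rightarrow> bool" where
  "minimal_generating_set G S \<longleftrightarrow>
     S \<subseteq> carrier G \<and> generate G S = carrier G \<and>
     \<not> (\<exists>T \<subseteq> carrier G. generate G T = carrier G \<and> T \<prec> S)"

definition P :: "int^3^3" where
  "P = vector [vector [0, -1, 0],
               vector [0,  0, 1],
               vector [1,  0, 0]]"

definition t12 :: "int^3^3" where
  "t12 = vector [vector [1, 1, 0],
                 vector [0, 1, 0],
                 vector [0, 0, 1]]"

end

theory Submission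
  imports Defs
begin

text \<open>
  Write \<open>t\<^sub>i\<^sub>j\<close> for the transvection that differs from the identity by a \<open>1\<close> at position \<open>(i, j)\<close>.
  The matrix \<^const>\<open>P\<close> permutes the coordinate axes cyclically, up to one sign, so conjugation by it
  carries \<open>t\<^sub>1\<^sub>2\<close> to \<open>t\<^sub>3\<^sub>1\<close> and then to \<open>t\<^sub>2\<^sub>3\<close>, up to inverses. The commutators
  \<open>[t\<^sub>i\<^sub>j, t\<^sub>j\<^sub>k] = t\<^sub>i\<^sub>k\<close> supply the other three (\<open>transvection_commutator\<close>). Moreover
  \<open>P\<^sup>3 = -1\<close>, so the generated group contains all transvections and a matrix of determinant \<open>-1\<close>.

  These suffice to generate everything (\<open>transvection_subgroup.eq_carrier\<close>): multiplying from the
  left by transvections performs integral row operations, and the Euclidean algorithm on pairs of rows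
  brings every matrix to upper triangular form. As the determinant is \<open>\<plusminus>1\<close>, so are the diagonal
  entries; hence the entries above the diagonal can be cleared, and a diagonal matrix of signs remains.
  An even number of signs \<open>-1\<close> comes from squares of quarter turns in coordinate planes, an odd
  number from \<open>-1\<close> times such a matrix.

  Two generators are necessary because a group generated by at most one element is commutative,
  while \<^const>\<open>P\<close> and \<^const>\<open>t12\<close> do not commute.
\<close>

section \<open>Transvections and quarter turns\<close>

definition transvection :: "3 \<Rightarrow> 3 \<Rightarrow> int \<Rightarrow> int^3^3" where
  "transvection i j c = (\<chi> k l. (if k = l then 1 else 0) + (if k = i \<and> l = j then c else 0))"

text \<open>
  Reading products row by row turns identities between products of transvections into
  bookkeeping with rows that is uniform in the indices, without expanding matrix entries.
\<close>

lemma transvection_mult_row: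
  "(transvection i j c ** A) $ k = (if k = i then A $ i + c *s A $ j else A $ k)"
proof -
  have "(\<Sum>m\<in>UNIV. ((if k = m then 1 else 0) + (if k = i \<and> m = j then c else 0)) * A $ m $ l)
      = A $ k $ l + (if k = i then c * A $ j $ l else 0)" for l
    by (cases "k = i") (simp_all add: distrib_right sum.distrib if_distrib[where f="\<lambda>x. x * _"] cong: if_cong)
  then show ?thesis
    by (simp add: vec_eq_iff matrix_matrix_mult_def transvection_def)
qed

lemma transvection_add:
  assumes "i \<noteq> j"
  shows "transvection i j (a + b) = transvection i j a ** transvection i j b"
  using assms unfolding vec_eq_iff[where x="transvection i j (a + b)"] transvection_mult_row
  by (auto simp: transvection_def vec_eq_iff)

text \<open>
  The right-hand side is the commutator of \<open>t\<^sub>i\<^sub>j\<close> and \<open>t\<^sub>j\<^sub>k\<close>. With \<open>E\<^sub>i\<^sub>j\<close> denoting the matrix units,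
  the identity reflects \<open>E\<^sub>i\<^sub>j E\<^sub>j\<^sub>k = E\<^sub>i\<^sub>k\<close>, all other products of the two being \<open>0\<close>.
\<close>

lemma transvection_commutator:
  assumes "i \<noteq> j" "j \<noteq> k" "i \<noteq> k"
  shows "transvection i k 1 =
    transvection i j 1 ** (transvection j k 1 ** (transvection i j (-1) ** transvection j k (-1)))"
  using assms unfolding vec_eq_iff[where x="transvection i k 1"] transvection_mult_row
  by (auto simp: transvection_def vec_eq_iff)

text \<open>
  The rotation by a right angle in the plane of the axes \<open>i\<close> and \<open>j\<close>. It stands in for the
  transposition of two rows, which has determinant \<open>-1\<close> and is therefore no product of transvections.
\<close>

definition quarter_turn :: "3 \<Rightarrow> 3 \<Rightarrow> int^3^3" where
  "quarter_turn i j = transvection i j 1 ** (transvection j i (-1) ** transvection i j 1)"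

lemma quarter_turn_mult_row:
  assumes "i \<noteq> j"
  shows "(quarter_turn i j ** A) $ k = (if k = i then A $ j else if k = j then - A $ i else A $ k)"
  using assms
  by (simp add: quarter_turn_def matrix_mul_assoc[symmetric] transvection_mult_row vec_eq_iff)

section \<open>Row reduction over the integers\<close>

lemma ESL3_simps [simp]:
  "x \<otimes>\<^bsub>ESL3\<^esub> y = x ** y" "\<one>\<^bsub>ESL3\<^esub> = mat 1"
  "x \<in> carrier ESL3 \<longleftrightarrow> det x = 1 \<or> det x = -1"
  by (auto simp: ESL3_def)

lemma subgroup_ESL3_mult: "subgroup H ESL3 \<Longrightarrow> A \<in> H \<Longrightarrow> B \<in> H \<Longrightarrow> A ** B \<in> H"
  using subgroup.m_closed[of H ESL3 A B] by simp

locale transvection_subgroup =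
  fixes H :: "(int^3^3) set"
  assumes subgroup: "subgroup H ESL3"
    and transvection_mem: "\<And>i j c. i \<noteq> j \<Longrightarrow> transvection i j c \<in> H"
    and neg_one_mem: "- mat 1 \<in> H"
begin

lemmas mult_mem = subgroup_ESL3_mult[OF subgroup]

lemma det_mem: "A \<in> H \<Longrightarrow> det A = 1 \<or> det A = -1"
  using subgroup.subset[OF subgroup] by auto

lemma quarter_turn_mem: "i \<noteq> j \<Longrightarrow> quarter_turn i j \<in> H"
  by (auto simp: quarter_turn_def intro!: mult_mem transvection_mem)

definition row_equiv :: "int^3^3 \<Rightarrow> int^3^3 \<Rightarrow> bool" where
  "row_equiv A B \<longleftrightarrow> (\<exists>h\<in>H. B = h ** A)"

lemma row_equiv_refl: "row_equiv A A"
  using subgroup.one_closed[OF subgroup] by (force simp: row_equiv_def)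

lemma row_equiv_trans: "row_equiv A B \<Longrightarrow> row_equiv B C \<Longrightarrow> row_equiv A C"
  unfolding row_equiv_def by (metis mult_mem matrix_mul_assoc)

lemma row_equiv_mult: "h \<in> H \<Longrightarrow> row_equiv A (h ** A)"
  by (auto simp: row_equiv_def)

lemma mem_if_row_equiv_mem:
  assumes "row_equiv A B" "B \<in> H"
  shows "A \<in> H"
proof -
  interpret group ESL3 by (rule group_ESL3)
  obtain h where h: "h \<in> H" "B = h ** A"
    using assms(1) by (auto simp: row_equiv_def)
  have "inv\<^bsub>ESL3\<^esub> h \<otimes>\<^bsub>ESL3\<^esub> h = \<one>\<^bsub>ESL3\<^esub>"
    using det_mem[OF h(1)] by (intro l_inv) simp
  then have "inv\<^bsub>ESL3\<^esub> h ** B = A"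
    by (simp add: h(2) matrix_mul_assoc)
  then show ?thesis
    using mult_mem[OF subgroup.m_inv_closed[OF subgroup h(1)] assms(2)] by simp
qed

text \<open>
  The Euclidean algorithm on the entries of column \<open>l\<close> in rows \<open>i\<close> and \<open>j\<close>. The last conjunct says
  that columns already cleared in both rows stay cleared, so that successive reductions do not undo
  one another.
\<close>

lemma row_equiv_clear_entry:
  assumes "i \<noteq> j"
  shows "\<exists>B. row_equiv A B \<and> B $ j $ l = 0 \<and> (\<forall>k. k \<noteq> i \<longrightarrow> k \<noteq> j \<longrightarrow> B $ k = A $ k)
    \<and> (\<forall>m. A $ i $ m = 0 \<longrightarrow> A $ j $ m = 0 \<longrightarrow> B $ i $ m = 0 \<and> B $ j $ m = 0)"
proof (induction "nat \<bar>A $ j $ l\<bar>" arbitrary: A rule: less_induct)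
  case less
  show ?case
  proof (cases "A $ j $ l = 0")
    case True
    then show ?thesis using row_equiv_refl by blast
  next
    case False
    \<comment> \<open>One division step: reduce row \<open>i\<close> modulo row \<open>j\<close>, then exchange the two rows up to sign,
      which puts the (negated) remainder into row \<open>j\<close>.\<close>
    define q where "q = A $ i $ l div A $ j $ l"
    define C where "C = quarter_turn i j ** (transvection i j (- q) ** A)"
    have C: "C $ k = (if k = i then A $ j else if k = j then q *s A $ j - A $ i else A $ k)" for k
      using assms by (simp add: C_def quarter_turn_mult_row transvection_mult_row vec_eq_iff)
    have AC: "row_equiv A C"
      unfolding C_def using assms
      by (intro row_equiv_trans[OF row_equiv_mult row_equiv_mult] transvection_mem quarter_turn_mem)
    have "C $ j $ l = - (A $ i $ l mod A $ j $ l)"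
      using assms by (simp add: C q_def minus_div_mult_eq_mod[symmetric])
    then have "nat \<bar>C $ j $ l\<bar> < nat \<bar>A $ j $ l\<bar>"
      using False abs_mod_less[OF False, of "A $ i $ l"] by simp
    from less[OF this] obtain B where B: "row_equiv C B" "B $ j $ l = 0"
      "\<forall>k. k \<noteq> i \<longrightarrow> k \<noteq> j \<longrightarrow> B $ k = C $ k"
      "\<forall>m. C $ i $ m = 0 \<longrightarrow> C $ j $ m = 0 \<longrightarrow> B $ i $ m = 0 \<and> B $ j $ m = 0" by blast
    show ?thesis
      using B assms row_equiv_trans[OF AC B(1)] by (intro exI[of _ B]) (simp add: C)
  qed
qed

lemma row_equiv_upper_triangular:
  "\<exists>B. row_equiv A B \<and> B $ 2 $ 1 = 0 \<and> B $ 3 $ 1 = 0 \<and> B $ 3 $ 2 = 0"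
proof -
  obtain B where B: "row_equiv A B" "B $ 2 $ 1 = 0"
    using row_equiv_clear_entry[of 1 2 A 1] by auto
  obtain C where C: "row_equiv B C" "C $ 3 $ 1 = 0" "C $ 2 $ 1 = 0"
    using row_equiv_clear_entry[of 1 3 B 1] B(2) by auto
  obtain D where D: "row_equiv C D" "D $ 3 $ 2 = 0" "D $ 2 $ 1 = 0" "D $ 3 $ 1 = 0"
    using row_equiv_clear_entry[of 2 3 C 2] C by auto
  then show ?thesis
    using row_equiv_trans[OF B(1) row_equiv_trans[OF C(1) D(1)]] by blast
qed

definition diagonal :: "int \<Rightarrow> int \<Rightarrow> int \<Rightarrow> int^3^3" where
  "diagonal x y z = vector [vector [x, 0, 0], vector [0, y, 0], vector [0, 0, z]]"

lemma diagonal_mult: "diagonal x y z ** diagonal x' y' z' = diagonal (x * x') (y * y') (z * z')"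
  by (simp add: diagonal_def vec_eq_iff forall_3 matrix_matrix_mult_def sum_3)

text \<open>
  The eight sign patterns form an elementary abelian group with basis the squares of two quarter turns,
  which negate two rows each, and \<open>-1\<close>.
\<close>

lemma sign_diagonal_mem:
  assumes "\<bar>x\<bar> = 1" "\<bar>y\<bar> = 1" "\<bar>z\<bar> = 1"
  shows "diagonal x y z \<in> H"
proof -
  have one: "diagonal 1 1 1 = mat 1" and neg: "diagonal (-1) (-1) (-1) = - mat 1"
    by (simp_all add: diagonal_def vec_eq_iff forall_3 mat_def)
  have "diagonal (-1) (-1) 1 = quarter_turn 1 2 ** (quarter_turn 1 2 ** mat 1)"
    unfolding vec_eq_iff[where x="diagonal (-1) (-1) 1"] forall_3
    by (simp add: quarter_turn_mult_row del: matrix_mul_rid)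
       (simp add: diagonal_def vec_eq_iff forall_3 mat_def)
  then have a: "diagonal (-1) (-1) 1 \<in> H"
    by (simp add: mult_mem quarter_turn_mem)
  have "diagonal 1 (-1) (-1) = quarter_turn 2 3 ** (quarter_turn 2 3 ** mat 1)"
    unfolding vec_eq_iff[where x="diagonal 1 (-1) (-1)"] forall_3
    by (simp add: quarter_turn_mult_row del: matrix_mul_rid)
       (simp add: diagonal_def vec_eq_iff forall_3 mat_def)
  then have b: "diagonal 1 (-1) (-1) \<in> H"
    by (simp add: mult_mem quarter_turn_mem)
  have n: "diagonal (-1) (-1) (-1) \<in> H" using neg neg_one_mem by simp
  have o: "diagonal 1 1 1 \<in> H" using one subgroup.one_closed[OF subgroup] by simp
  note ab = mult_mem[OF a b, unfolded diagonal_mult]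
  have "x = 1 \<or> x = -1" "y = 1 \<or> y = -1" "z = 1 \<or> z = -1" using assms by linarith+
  then show ?thesis
    using o n a b ab mult_mem[OF n a] mult_mem[OF n b] mult_mem[OF n ab]
    by (auto simp: diagonal_mult)
qed

text \<open>
  The diagonal entries divide the determinant, so they are units and can serve as pivots for clearing
  the entries above them.
\<close>

lemma upper_triangular_mem:
  assumes "\<bar>det A\<bar> = 1" "A $ 2 $ 1 = 0" "A $ 3 $ 1 = 0" "A $ 3 $ 2 = 0"
  shows "A \<in> H"
proof -
  let ?x = "A $ 1 $ 1" and ?y = "A $ 2 $ 2" and ?z = "A $ 3 $ 3"
  have "?x * ?y * ?z dvd 1"
    using assms by (simp add: det_3)
  then have "?x dvd 1" "?y dvd 1" "?z dvd 1"
    by (simp_all only: is_unit_mult_iff)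
  then have s: "\<bar>?x\<bar> = 1" "\<bar>?y\<bar> = 1" "\<bar>?z\<bar> = 1"
    by (simp_all only: zdvd1_eq)
  have sq: "?y * ?y = 1" "?z * ?z = 1"
    using s by (metis abs_mult_self_eq mult_1)+
  \<comment> \<open>The pivots are their own inverses, so dividing by them is multiplying by them. Clearing the
    third column with row \<open>3\<close> leaves the entry at \<open>(1, 2)\<close> unchanged.\<close>
  define B where "B = transvection 1 3 (- (A $ 1 $ 3 * ?z)) **
     (transvection 2 3 (- (A $ 2 $ 3 * ?z)) ** A)"
  define C where "C = transvection 1 2 (- (A $ 1 $ 2 * ?y)) ** B"
  have "C = diagonal ?x ?y ?z"
    using assms sq
    by (simp add: C_def B_def transvection_mult_row vec_eq_iff forall_3 diagonal_def mult.assoc)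
  moreover have "row_equiv A C"
    unfolding C_def B_def
    by (intro row_equiv_trans[OF row_equiv_trans[OF row_equiv_mult row_equiv_mult] row_equiv_mult]
        transvection_mem) auto
  ultimately show ?thesis
    using mem_if_row_equiv_mem sign_diagonal_mem[OF s] by simp
qed

lemma eq_carrier: "H = carrier ESL3"
proof
  show "H \<subseteq> carrier ESL3" by (rule subgroup.subset[OF subgroup])
  show "carrier ESL3 \<subseteq> H"
  proof
    fix A assume A: "A \<in> carrier ESL3"
    obtain B where B: "row_equiv A B" "B $ 2 $ 1 = 0" "B $ 3 $ 1 = 0" "B $ 3 $ 2 = 0"
      using row_equiv_upper_triangular by blast
    obtain h where "h \<in> H" "B = h ** A" using B(1) by (auto simp: row_equiv_def)
    then have "\<bar>det B\<bar> = 1" using A det_mem[of h] by (auto simp: det_mul)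
    then show "A \<in> H" using upper_triangular_mem mem_if_row_equiv_mem B by blast
  qed
qed

end

section \<open>The two generators\<close>

lemma det_P: "det P = -1" and det_t12: "det t12 = 1"
  by (simp_all add: det_3 P_def t12_def)

lemma transvection_mem_if_unit:
  assumes "subgroup H ESL3" "i \<noteq> j" "transvection i j 1 \<in> H"
  shows "transvection i j c \<in> H"
proof -
  interpret group ESL3 by (rule group_ESL3)
  note mult = subgroup_ESL3_mult[OF assms(1)]
  have zero: "transvection i j 0 = mat 1"
    by (simp add: transvection_def mat_def vec_eq_iff)
  have car: "transvection i j 1 \<in> carrier ESL3"
    using subgroup.subset[OF assms(1)] assms(3) by blast
  have inv: "transvection i j (-1) ** transvection i j 1 = mat 1"
    using transvection_add[OF assms(2), of "-1" 1] zero by simp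
  \<comment> \<open>Uniqueness of inverses applies only once the candidate is known to lie in the group.\<close>
  have "det (transvection i j (-1)) * det (transvection i j 1) = 1"
    using inv by (metis det_mul det_I)
  then have "transvection i j (-1) \<in> carrier ESL3" using car by auto
  then have "inv\<^bsub>ESL3\<^esub> (transvection i j 1) = transvection i j (-1)"
    using car inv by (intro inv_equality) auto
  then have neg: "transvection i j (-1) \<in> H"
    using subgroup.m_inv_closed[OF assms(1) assms(3)] by simp
  show ?thesis
  proof (induction c rule: int_induct[where k=0])
    case base
    show ?case using zero subgroup.one_closed[OF assms(1)] by simp
  next
    case (step1 c)
    then show ?case using mult[OF _ assms(3)] transvection_add[OF assms(2)] by simp
  next
    case (step2 c)
    then show ?case using mult[OF _ neg] transvection_add[OF assms(2), of c "-1"] by simp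
  qed
qed

lemma transvection_commutator_mem:
  assumes "subgroup H ESL3" "i \<noteq> j" "j \<noteq> k" "i \<noteq> k"
    "transvection i j 1 \<in> H" "transvection j k 1 \<in> H"
  shows "transvection i k 1 \<in> H"
proof -
  note mult = subgroup_ESL3_mult[OF assms(1)]
  show ?thesis
    unfolding transvection_commutator[OF assms(2-4)]
    by (intro mult assms(5,6) transvection_mem_if_unit[OF assms(1,2,5)]
        transvection_mem_if_unit[OF assms(1,3,6)])
qed

lemma generate_P_t12: "generate ESL3 {P, t12} = carrier ESL3"
proof -
  interpret group ESL3 by (rule group_ESL3)
  define H where "H = generate ESL3 {P, t12}"
  have H: "subgroup H ESL3"
    unfolding H_def by (rule generate_is_subgroup) (auto simp: det_P det_t12)
  note mult = subgroup_ESL3_mult[OF H]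
  have P: "P \<in> H" and t12: "t12 \<in> H"
    unfolding H_def by (auto intro: generate.incl)
  have P3: "P ** (P ** P) = - mat 1"
    by (simp add: P_def vec_eq_iff forall_3 matrix_matrix_mult_def sum_3 mat_def)
  then have neg: "- mat 1 \<in> H" using mult[OF P mult[OF P P]] by simp
  have unit: "transvection i j 1 \<in> H \<Longrightarrow> i \<noteq> j \<Longrightarrow> transvection i j c \<in> H" for i j c
    using transvection_mem_if_unit[OF H] by blast
  have comm: "transvection i j 1 \<in> H \<Longrightarrow> transvection j k 1 \<in> H \<Longrightarrow> i \<noteq> j \<Longrightarrow> j \<noteq> k \<Longrightarrow> i \<noteq> k
    \<Longrightarrow> transvection i k 1 \<in> H" for i j k
    using transvection_commutator_mem[OF H] by blast
  have t_12: "transvection 1 2 1 \<in> H"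
  proof -
    have "transvection 1 2 1 = t12"
      by (simp add: transvection_def t12_def vec_eq_iff forall_3)
    then show ?thesis using t12 by simp
  qed
  \<comment> \<open>In the next two conjugations, \<open>P ** (P ** - mat 1)\<close> is the inverse of \<^const>\<open>P\<close>. The entry \<open>-1\<close>
    of \<^const>\<open>P\<close> reverses a sign in the first one, which therefore starts from the inverse of \<^const>\<open>t12\<close>.\<close>
  have t_31: "transvection 3 1 1 \<in> H"
  proof -
    have "transvection 3 1 1 = P ** (transvection 1 2 (-1) ** (P ** (P ** (- mat 1))))"
      by (simp add: transvection_def P_def vec_eq_iff forall_3 matrix_matrix_mult_def sum_3 mat_def)
    then show ?thesis by (simp del: matrix_mul_rid add: mult P neg unit[OF t_12])
  qed
  have t_23: "transvection 2 3 1 \<in> H"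
  proof -
    have "transvection 2 3 1 = P ** (transvection 3 1 1 ** (P ** (P ** (- mat 1))))"
      by (simp add: transvection_def P_def vec_eq_iff forall_3 matrix_matrix_mult_def sum_3 mat_def)
    then show ?thesis by (simp del: matrix_mul_rid add: mult P neg t_31)
  qed
  have "transvection 1 3 1 \<in> H" "transvection 2 1 1 \<in> H" "transvection 3 2 1 \<in> H"
    using comm[OF t_12 t_23] comm[OF t_23 t_31] comm[OF t_31 t_12] by auto
  then have "\<forall>i j. i \<noteq> j \<longrightarrow> transvection i j 1 \<in> H"
    using t_12 t_23 t_31 by (simp add: forall_3)
  then interpret transvection_subgroup H
    using H neg unit by (intro transvection_subgroup.intro) auto
  show ?thesis using eq_carrier H_def by simp
qed

section \<open>One generator is not enough\<close>

lemma P_t12_not_commute: "P ** t12 \<noteq> t12 ** P"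
  by (simp add: P_def t12_def vec_eq_iff forall_3 matrix_matrix_mult_def sum_3)

lemma (in group) generate_single_commute:
  assumes "a \<in> carrier G" "x \<in> generate G {a}" "y \<in> generate G {a}"
  shows "x \<otimes> y = y \<otimes> x"
  using assms by (auto simp: generate_pow[OF assms(1)] int_pow_mult[symmetric] add.commute)

lemma subset_singleton_if_lesspoll_pair:
  assumes "T \<prec> {x, y}"
  shows "T = {} \<or> (\<exists>a. T = {a})"
proof -
  have "{x, y} \<lesssim> {..<2 :: nat}"
    by (simp add: lepoll_iff_card_le card_insert_if)
  with assms have "T \<prec> {..<2 :: nat}"
    by (rule lesspoll_trans2)
  then have fin: "finite T" and "card T < 2"
    by (simp_all add: lesspoll_iff_finite_card)
  then have "card T = 0 \<or> card T = 1"
    by linarith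
  then show ?thesis using fin by (auto simp: card_1_singleton_iff)
qed

theorem proposition1:
  shows "minimal_generating_set ESL3 {P, t12} \<and> card {P, t12} = 2"
proof -
  interpret group ESL3 by (rule group_ESL3)
  have False if T: "T \<subseteq> carrier ESL3" "generate ESL3 T = carrier ESL3" "T \<prec> {P, t12}" for T
  proof -
    \<comment> \<open>If \<open>T\<close> is empty, the identity serves as \<open>a\<close>.\<close>
    obtain a where a: "a \<in> carrier ESL3" "T \<subseteq> {a}"
      using subset_singleton_if_lesspoll_pair[OF T(3)] T(1) one_closed by blast
    have "carrier ESL3 \<subseteq> generate ESL3 {a}"
      using mono_generate[OF a(2)] T(2) by simp
    then have "P \<in> generate ESL3 {a}" "t12 \<in> generate ESL3 {a}"
      by (auto simp: det_P det_t12 subset_iff)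
    from generate_single_commute[OF a(1) this] show False
      using P_t12_not_commute by simp
  qed
  moreover have "P \<noteq> t12" using P_t12_not_commute by auto
  ultimately show ?thesis
    using generate_P_t12 by (auto simp: minimal_generating_set_def det_P det_t12)
qed

end
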